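(* Right-orderable groups have uniform twin-width $2$.
   Context: A group $\Gamma$ is right-orderable if it admits a total order $<$ such that for all $x,y,z\in\Gamma$, $x<y$ implies $xz<yz$. For totally ordered sets $X,Y$, an $X\times Y$ matrix is a map $M:X\times Y\to\{0,1\}$. If $M$ is finite, a division of $M$ is a pair $(\mathcal X,\mathcal Y)$ of partitions of $X$ and $Y$ into intervals; the quotient $M/(\mathcal X,\mathcal Y)$ is the $\mathcal X\times\mathcal Y$ matrix with entry $1$ at $(X_i,Y_j)$ iff $M$ has a $1$-entry in $X_i\times Y_j$. A division sequence of $M$ is a sequence of divisions starting with the division into singletons, ending with $(\{X\},\{Y\})$, each obtained from the previous one by merging two (consecutive) parts of $\mathcal X$ or two of $\mathcal Y$. Its width is the maximum number of $1$-entries in a row or column of a quotient matrix along the sequence. The strict twin-width $\mathrm{stww}(M)$ is the minimum width of a division sequence; for infinite $M$ it is the supremum over finite submatrices. For a group $G$, a total order $<$ on $G$ and $g\in G$, let $M_g^<$ be the $(G,<)\times(G,<)$ matrix with $M_g^<(x,y)=1$ iff $xg=y$. The uniform twin-width of $G$ is $\mathrm{utww}(G)=\min_{<}\ \sup_{g\in G}\mathrm{stww}(M_g^<)\in\mathbb N\cup\{\infty\}$, the minimum being over all total orders $<$ on $G$.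
   Formalization: The equality with 2 is stated for nontrivial right-orderable groups only, since the trivial group has uniform twin-width 1; for all right-orderable groups the bound of at most 2 is stated. *)

theory Defs
  imports
    "HOL-Algebra.Group"
    "HOL-Library.Disjoint_Sets"
    "HOL-Library.Extended_Nat"
begin

text \<open>
  A total order on a set \<open>X\<close> is a reflexive relation \<open>r\<close> with \<^term>\<open>linear_order_on X r\<close>;
  its strict part is \<open>(x, y) \<in> r \<and> x \<noteq> y\<close>.
\<close>

definition right_orderable :: "('a, 'b) monoid_scheme \<Rightarrow> bool" where
  "right_orderable G \<longleftrightarrow>
     (\<exists>r. linear_order_on (carrier G) r \<and>
          (\<forall>x\<in>carrier G. \<forall>y\<in>carrier G. \<forall>z\<in>carrier G.
             (x, y) \<in> r \<and> x \<noteq> y \<longrightarrow>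
             (x \<otimes>\<^bsub>G\<^esub> z, y \<otimes>\<^bsub>G\<^esub> z) \<in> r \<and> x \<otimes>\<^bsub>G\<^esub> z \<noteq> y \<otimes>\<^bsub>G\<^esub> z))"

text \<open>
  An \<open>X \<times> Y\<close> matrix with entries in \<open>{0, 1}\<close> is a function \<open>M :: 'a \<Rightarrow> 'b \<Rightarrow> bool\<close>,
  of which only the values on \<open>X \<times> Y\<close> matter; the index sets and their orders are passed
  separately. The orders are only ever compared on the index sets, so a submatrix on
  \<open>X' \<subseteq> X\<close> and \<open>Y' \<subseteq> Y\<close> can keep the orders of \<open>X\<close> and \<open>Y\<close>.
\<close>

definition interval_in :: "'a set \<Rightarrow> 'a rel \<Rightarrow> 'a set \<Rightarrow> bool" where
  "interval_in X r I \<longleftrightarrow>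
     I \<subseteq> X \<and> (\<forall>a\<in>I. \<forall>b\<in>I. \<forall>c\<in>X. (a, c) \<in> r \<and> (c, b) \<in> r \<longrightarrow> c \<in> I)"

definition interval_partition :: "'a set \<Rightarrow> 'a rel \<Rightarrow> 'a set set \<Rightarrow> bool" where
  "interval_partition X r P \<longleftrightarrow> partition_on X P \<and> (\<forall>I\<in>P. interval_in X r I)"

definition division ::
  "'a set \<Rightarrow> 'a rel \<Rightarrow> 'b set \<Rightarrow> 'b rel \<Rightarrow> 'a set set \<times> 'b set set \<Rightarrow> bool" where
  "division X r Y s D \<longleftrightarrow> interval_partition X r (fst D) \<and> interval_partition Y s (snd D)"

definition quotient_matrix :: "('a \<Rightarrow> 'b \<Rightarrow> bool) \<Rightarrow> 'a set \<Rightarrow> 'b set \<Rightarrow> bool" where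
  "quotient_matrix M A B \<longleftrightarrow> (\<exists>x\<in>A. \<exists>y\<in>B. M x y)"

text \<open>
  The merged parts are not required to be consecutive here: in a division sequence the result
  is again a division, so their union is an interval, which forces them to be consecutive.
\<close>

definition merge_parts :: "'a set set \<Rightarrow> 'a set set \<Rightarrow> bool" where
  "merge_parts P P' \<longleftrightarrow> (\<exists>A\<in>P. \<exists>B\<in>P. A \<noteq> B \<and> P' = insert (A \<union> B) (P - {A, B}))"

definition merge_step ::
  "'a set set \<times> 'b set set \<Rightarrow> 'a set set \<times> 'b set set \<Rightarrow> bool" where
  "merge_step D D' \<longleftrightarrow>
     merge_parts (fst D) (fst D') \<and> snd D' = snd D \<or>
     fst D' = fst D \<and> merge_parts (snd D) (snd D')"

definition singletons :: "'a set \<Rightarrow> 'a set set" where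
  "singletons X = (\<lambda>x. {x}) ` X"

definition division_sequence ::
  "'a set \<Rightarrow> 'a rel \<Rightarrow> 'b set \<Rightarrow> 'b rel \<Rightarrow> ('a set set \<times> 'b set set) list \<Rightarrow> bool" where
  "division_sequence X r Y s Ds \<longleftrightarrow>
     Ds \<noteq> [] \<and> (\<forall>D\<in>set Ds. division X r Y s D) \<and>
     hd Ds = (singletons X, singletons Y) \<and> last Ds = ({X}, {Y}) \<and>
     successively merge_step Ds"

definition line_counts :: "'c set \<Rightarrow> 'd set \<Rightarrow> ('c \<Rightarrow> 'd \<Rightarrow> bool) \<Rightarrow> nat set" where
  "line_counts R C N = (\<lambda>i. card {j \<in> C. N i j}) ` R \<union> (\<lambda>j. card {i \<in> R. N i j}) ` C"

definition sequence_width ::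
  "('a \<Rightarrow> 'b \<Rightarrow> bool) \<Rightarrow> ('a set set \<times> 'b set set) list \<Rightarrow> nat" where
  "sequence_width M Ds = Max (\<Union>D\<in>set Ds. line_counts (fst D) (snd D) (quotient_matrix M))"

text \<open>
  For finite nonempty \<open>X\<close> and \<open>Y\<close> division sequences exist, so the infimum is a minimum.
  If \<open>X\<close> or \<open>Y\<close> is empty there is none, since \<open>{{}}\<close> is not a partition; hence the restriction
  to nonempty submatrices in the infinite case.
\<close>

definition finite_stww ::
  "'a set \<Rightarrow> 'a rel \<Rightarrow> 'b set \<Rightarrow> 'b rel \<Rightarrow> ('a \<Rightarrow> 'b \<Rightarrow> bool) \<Rightarrow> enat" where
  "finite_stww X r Y s M = (INF Ds \<in> {Ds. division_sequence X r Y s Ds}. enat (sequence_width M Ds))"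

definition stww ::
  "'a set \<Rightarrow> 'a rel \<Rightarrow> 'b set \<Rightarrow> 'b rel \<Rightarrow> ('a \<Rightarrow> 'b \<Rightarrow> bool) \<Rightarrow> enat" where
  "stww X r Y s M =
     (if finite X \<and> finite Y then finite_stww X r Y s M
      else (SUP (X', Y') \<in> {(X', Y'). X' \<subseteq> X \<and> finite X' \<and> X' \<noteq> {} \<and>
                                     Y' \<subseteq> Y \<and> finite Y' \<and> Y' \<noteq> {}}.
              finite_stww X' r Y' s M))"

definition translation_matrix :: "('a, 'b) monoid_scheme \<Rightarrow> 'a \<Rightarrow> 'a \<Rightarrow> 'a \<Rightarrow> bool" where
  "translation_matrix G g x y \<longleftrightarrow> x \<otimes>\<^bsub>G\<^esub> g = y"

text \<open>
  The infimum is attained because \<open>enat\<close> is well-ordered and every set has a total order.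
\<close>

definition utww :: "('a, 'b) monoid_scheme \<Rightarrow> enat" where
  "utww G =
     (INF r \<in> {r. linear_order_on (carrier G) r}.
        SUP g \<in> carrier G. stww (carrier G) r (carrier G) r (translation_matrix G g))"

end

theory Submission
  imports Defs
begin

text \<open>
  For a right-invariant order, \<open>x \<mapsto> x g\<close> is increasing, so the 1-entries of a finite submatrix
  of the translation matrix form an increasing partial matching. Such a matrix is contracted by
  growing an initial segment \<open>A\<close> of the rows and an initial segment \<open>B\<close> of the columns, all other
  parts remaining singletons. As the matching is increasing, it cannot lead both from \<open>A\<close> out
  of \<open>B\<close> and from outside \<open>A\<close> into \<open>B\<close>; hence one can always extend the segment that lags behind,
  keeping at most one 1-entry in the row \<open>A\<close> besides the one in column \<open>B\<close>, and conversely.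
  For the lower bound, \<open>g = \<one>\<close> gives an identity matrix, where the first merge
  already creates a row or column with two 1-entries.
\<close>

section \<open>Initial segments and the divisions they induce\<close>

lemma finite_linear_order_minimum:
  assumes "linear_order_on C r" and "finite S" "S \<noteq> {}" "S \<subseteq> C"
  shows "\<exists>m\<in>S. \<forall>x\<in>S. (m, x) \<in> r"
  using assms(2-4)
proof (induction rule: finite_ne_induct)
  case (singleton x)
  then show ?case using assms(1) by (auto simp: order_on_defs refl_on_def)
next
  case (insert x F)
  then obtain m where m: "m \<in> F" "\<forall>y\<in>F. (m, y) \<in> r" by auto
  have tr: "trans r" and xx: "(x, x) \<in> r" and tot: "(x, m) \<in> r \<or> (m, x) \<in> r"
    using assms(1) insert.prems insert.hyps m(1)
    by (auto simp: order_on_defs refl_on_def total_on_def)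
  from tot show ?case
  proof
    assume "(x, m) \<in> r"
    then have "\<forall>y\<in>insert x F. (x, y) \<in> r" using m tr xx by (auto dest: transD)
    then show ?thesis by blast
  next
    assume "(m, x) \<in> r"
    then show ?thesis using m by blast
  qed
qed

definition initial_segment :: "'a set \<Rightarrow> 'a rel \<Rightarrow> 'a set \<Rightarrow> bool" where
  "initial_segment X r A \<longleftrightarrow> A \<subseteq> X \<and> (\<forall>a\<in>A. \<forall>x\<in>X. (x, a) \<in> r \<longrightarrow> x \<in> A)"

text \<open>For \<open>A = {}\<close> the inserted part would be empty and this would be no
  partition, so the contraction starts at a singleton \<open>A\<close>, where it is the partition
  into singletons.\<close>

definition collapse :: "'a set \<Rightarrow> 'a set \<Rightarrow> 'a set set" where
  "collapse X A = insert A (singletons (X - A))"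

lemma collapse_full: "collapse X X = {X}"
  by (simp add: collapse_def singletons_def)

lemma collapse_singleton: "x \<in> X \<Longrightarrow> collapse X {x} = singletons X"
  by (auto simp: collapse_def singletons_def)

text \<open>The minimum of \<open>X - A\<close> serves as \<open>x\<close>: every other element of
  \<open>X\<close> below it lies in \<open>A\<close>. The case \<open>A = {}\<close> is allowed and
  supplies the starting singleton.\<close>

lemma extend_initial_segment:
  assumes "linear_order_on C r" "X \<subseteq> C" "finite X" "initial_segment X r A" "A \<noteq> X"
  obtains x where "x \<in> X - A" "initial_segment X r (insert x A)"
proof -
  have "A \<subseteq> X" using assms(4) by (simp add: initial_segment_def)
  then obtain m where m: "m \<in> X - A" "\<forall>x\<in>X-A. (m, x) \<in> r"
    using finite_linear_order_minimum[OF assms(1), of "X - A"] assms by auto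
  have "initial_segment X r (insert m A)"
    using assms(1,4) m
    unfolding initial_segment_def order_on_defs antisym_def by blast
  with m show thesis using that by blast
qed

lemma interval_partition_collapse:
  assumes "linear_order_on C r" "X \<subseteq> C" "initial_segment X r A" "A \<noteq> {}"
  shows "interval_partition X r (collapse X A)"
proof -
  have an: "antisym r" using assms(1) by (simp add: order_on_defs)
  have "partition_on X (collapse X A)"
    using assms(3,4)
    by (auto simp: partition_on_def collapse_def singletons_def initial_segment_def
        disjoint_def)
  moreover have "interval_in X r I" if "I \<in> collapse X A" for I
    using that assms(3) an
    by (auto simp: interval_in_def collapse_def singletons_def initial_segment_def
        dest: antisymD)
  ultimately show ?thesis by (simp add: interval_partition_def)
qed

lemma merge_parts_collapse:
  assumes "x \<in> X - A" "A \<noteq> {}"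
  shows "merge_parts (collapse X A) (collapse X (insert x A))"
  unfolding merge_parts_def
proof (intro bexI conjI)
  show "A \<noteq> {x}" using assms by auto
  show "collapse X (insert x A) = insert (A \<union> {x}) (collapse X A - {A, {x}})"
    using assms by (auto simp: collapse_def singletons_def)
qed (use assms in \<open>auto simp: collapse_def singletons_def\<close>)

section \<open>Width of a division with one collapsed row and column\<close>

definition thin :: "('a \<Rightarrow> 'b \<Rightarrow> bool) \<Rightarrow> 'a set \<Rightarrow> 'b set \<Rightarrow> bool" where
  "thin M I Z \<longleftrightarrow> (\<forall>x\<in>I. \<forall>x'\<in>I. \<forall>y\<in>Z. \<forall>y'\<in>Z. M x y \<longrightarrow> M x' y' \<longrightarrow> y = y')"

text \<open>Outside \<open>B\<close> all columns are singleton parts, and by thinness at most one of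
  them meets \<open>I\<close>; the part \<open>B\<close> itself accounts for the second
  1-entry.\<close>

lemma thin_row_count:
  assumes "thin M I (Y - B)"
  shows "card {J \<in> collapse Y B. quotient_matrix M I J} \<le> 2"
proof -
  have "\<exists>J. {J \<in> collapse Y B. quotient_matrix M I J} \<subseteq> {B, J}"
  proof (cases "\<exists>x\<in>I. \<exists>y\<in>Y-B. M x y")
    case True
    then obtain x y where "x \<in> I" "y \<in> Y - B" "M x y" by blast
    then have "{J \<in> collapse Y B. quotient_matrix M I J} \<subseteq> {B, {y}}"
      using assms unfolding thin_def collapse_def singletons_def quotient_matrix_def by blast
    then show ?thesis by blast
  next
    case False
    \<comment> \<open>With no 1-entry outside \<open>B\<close>, the part \<open>B\<close> also
      serves as the dummy witness for \<open>J\<close>.\<close>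
    then have "{J \<in> collapse Y B. quotient_matrix M I J} \<subseteq> {B, B}"
      unfolding collapse_def singletons_def quotient_matrix_def by blast
    then show ?thesis by blast
  qed
  then obtain J where J: "{J \<in> collapse Y B. quotient_matrix M I J} \<subseteq> {B, J}" by blast
  have "card {B, J} \<le> 2" by (simp add: card_insert_if)
  then show ?thesis using card_mono[OF _ J] by simp
qed

lemma quotient_matrix_conversep: "quotient_matrix M\<inverse>\<inverse> J I = quotient_matrix M I J"
  by (auto simp: quotient_matrix_def)

text \<open>The use of equivalences makes the notion symmetric in rows and columns, so that facts
  about columns are facts about rows of \<open>M\<inverse>\<inverse>\<close>.\<close>

definition increasing_matching ::
  "'a set \<Rightarrow> 'a rel \<Rightarrow> 'b set \<Rightarrow> 'b rel \<Rightarrow> ('a \<Rightarrow> 'b \<Rightarrow> bool) \<Rightarrow> bool" where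
  "increasing_matching X r Y s M \<longleftrightarrow>
     (\<forall>x\<in>X. \<forall>x'\<in>X. \<forall>y\<in>Y. \<forall>y'\<in>Y. M x y \<longrightarrow> M x' y' \<longrightarrow>
        ((x, x') \<in> r \<longleftrightarrow> (y, y') \<in> s) \<and> (x = x' \<longleftrightarrow> y = y'))"

lemma increasing_matching_converse:
  "increasing_matching X r Y s M \<Longrightarrow> increasing_matching Y s X r M\<inverse>\<inverse>"
  unfolding increasing_matching_def conversep_iff by (intro ballI impI) simp

text \<open>The two thinness hypotheses handle the collapsed row and column. Every other line is a
  singleton, which is thin because a matching has at most one 1-entry per line.\<close>

lemma line_counts_collapse:
  assumes M: "increasing_matching X r Y s M" and "A \<subseteq> X" "B \<subseteq> Y"
    and thin: "thin M A (Y - B)" "thin M\<inverse>\<inverse> B (X - A)"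
  shows "line_counts (collapse X A) (collapse Y B) (quotient_matrix M) \<subseteq> {..2}"
proof -
  have "card {J \<in> collapse Y B. quotient_matrix M I J} \<le> 2" if "I \<in> collapse X A" for I
  proof (rule thin_row_count)
    show "thin M I (Y - B)"
      using that M thin(1)
      by (auto simp: collapse_def singletons_def thin_def increasing_matching_def)
  qed
  moreover have "card {I \<in> collapse X A. quotient_matrix M I J} \<le> 2"
    if "J \<in> collapse Y B" for J
  proof -
    have "thin M\<inverse>\<inverse> J (X - A)"
      using that M thin(2)
      by (auto simp: collapse_def singletons_def thin_def increasing_matching_def)
    from thin_row_count[OF this] show ?thesis by (simp add: quotient_matrix_conversep)
  qed
  ultimately show ?thesis by (auto simp: line_counts_def)
qed

section \<open>Contraction of increasing matchings\<close>

lemma thin_insert_row: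
  assumes "increasing_matching X r Y s M" "A \<subseteq> X" "B \<subseteq> Y" "x \<in> X"
    and "\<not> (\<exists>a\<in>A. \<exists>y\<in>Y-B. M a y)"
  shows "thin M (insert x A) (Y - B)"
  using assms unfolding thin_def increasing_matching_def by blast

lemma thin_mono: "thin M I Z \<Longrightarrow> Z' \<subseteq> Z \<Longrightarrow> thin M I Z'"
  unfolding thin_def by blast

text \<open>A 1-entry \<open>(x, b)\<close> with \<open>x\<close> outside \<open>A\<close> and
  \<open>b\<close> in \<open>B\<close> has \<open>a\<close> below \<open>x\<close>, since
  \<open>A\<close> is initial. Monotonicity then puts \<open>y\<close> below \<open>b\<close>, hence
  into \<open>B\<close>, a contradiction.\<close>

lemma increasing_matching_no_crossing:
  assumes "linear_order_on C r" "X \<subseteq> C"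
    and "increasing_matching X r Y s M" "initial_segment X r A" "initial_segment Y s B"
    and "a \<in> A" "y \<in> Y - B" "M a y"
  shows "\<not> (\<exists>b\<in>B. \<exists>x\<in>X-A. M\<inverse>\<inverse> b x)"
proof
  assume "\<exists>b\<in>B. \<exists>x\<in>X-A. M\<inverse>\<inverse> b x"
  then obtain b x where b: "b \<in> B" "x \<in> X - A" "M x b" by auto
  have a: "a \<in> X" "b \<in> Y" using assms(4-6) b(1) by (auto simp: initial_segment_def)
  have "(x, a) \<notin> r" "x \<noteq> a" using assms(4,6) b unfolding initial_segment_def by auto
  moreover have "total_on C r" using assms(1) by (simp add: order_on_defs)
  ultimately have "(a, x) \<in> r" using assms(2) a b by (auto simp: total_on_def)
  moreover have "(a, x) \<in> r \<longleftrightarrow> (y, b) \<in> s"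
    using assms(3,7,8) a b by (simp add: increasing_matching_def)
  ultimately have "(y, b) \<in> s" by simp
  then show False using assms(5,7) b unfolding initial_segment_def by blast
qed

text \<open>Induction on the number of rows outside \<open>A\<close> plus columns outside
  \<open>B\<close>: one segment grows by one element, and the current division is prepended to the
  sequence for the larger segment.\<close>

lemma contraction_from_collapse:
  assumes r: "linear_order_on C r" "X \<subseteq> C" "finite X"
    and s: "linear_order_on D s" "Y \<subseteq> D" "finite Y"
    and M: "increasing_matching X r Y s M"
    and "initial_segment X r A" "A \<noteq> {}" "initial_segment Y s B" "B \<noteq> {}"
    and "thin M A (Y - B)" "thin M\<inverse>\<inverse> B (X - A)"
  shows "\<exists>Ds. Ds \<noteq> [] \<and>
    (\<forall>E\<in>set Ds. division X r Y s E \<and> line_counts (fst E) (snd E) (quotient_matrix M) \<subseteq> {..2}) \<and>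
    hd Ds = (collapse X A, collapse Y B) \<and> last Ds = ({X}, {Y}) \<and> successively merge_step Ds"
    (is "\<exists>Ds. ?contraction A B Ds")
  using assms(8-)
proof (induction "card (X - A) + card (Y - B)" arbitrary: A B rule: less_induct)
  case less
  have sub: "A \<subseteq> X" "B \<subseteq> Y" using less.prems by (auto simp: initial_segment_def)
  let ?E = "(collapse X A, collapse Y B)"
  have E: "division X r Y s ?E"
      "line_counts (fst ?E) (snd ?E) (quotient_matrix M) \<subseteq> {..2}"
    using interval_partition_collapse[OF r(1,2) less.prems(1,2)]
      interval_partition_collapse[OF s(1,2) less.prems(3,4)]
      line_counts_collapse[OF M sub less.prems(5,6)]
    by (auto simp: division_def)
  have prepend: "\<exists>Ds. ?contraction A B Ds"
    if "?contraction A' B' Ds" "merge_step ?E (collapse X A', collapse Y B')" for A' B' Ds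
    using that E by (intro exI[of _ "?E # Ds"]) (auto simp: successively_Cons)
  \<comment> \<open>If no 1-entry leads from \<open>A\<close> out of \<open>B\<close>, the new row
    is the only source of such entries and has at most one. Thinness of \<open>B\<close> survives
    because \<open>X - A\<close> shrinks.\<close>
  have grow_A: ?case if "A \<noteq> X" and none: "\<not> (\<exists>a\<in>A. \<exists>y\<in>Y-B. M a y)"
  proof -
    obtain x where x: "x \<in> X - A" "initial_segment X r (insert x A)"
      using extend_initial_segment[OF r less.prems(1) \<open>A \<noteq> X\<close>] .
    have "card (X - insert x A) < card (X - A)"
      using x r(3) by (intro psubset_card_mono) auto
    moreover have "thin M (insert x A) (Y - B)"
      using thin_insert_row[OF M sub _ none] x by blast
    moreover have "thin M\<inverse>\<inverse> B (X - insert x A)"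
      using less.prems(6) by (rule thin_mono) auto
    ultimately obtain Ds where "?contraction (insert x A) B Ds"
      using less.hyps[of "insert x A" B] x(2) less.prems(3,4) by auto
    then show ?thesis
      by (rule prepend) (use merge_parts_collapse[OF x(1) less.prems(2)] in
          \<open>simp add: merge_step_def\<close>)
  qed
  have grow_B: ?case if "B \<noteq> Y" and none: "\<not> (\<exists>b\<in>B. \<exists>x\<in>X-A. M\<inverse>\<inverse> b x)"
  proof -
    obtain y where y: "y \<in> Y - B" "initial_segment Y s (insert y B)"
      using extend_initial_segment[OF s less.prems(3) \<open>B \<noteq> Y\<close>] .
    have "card (Y - insert y B) < card (Y - B)"
      using y s(3) by (intro psubset_card_mono) auto
    moreover have "thin M\<inverse>\<inverse> (insert y B) (X - A)"
      using thin_insert_row[OF increasing_matching_converse[OF M] sub(2,1) _ none] y by blast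
    moreover have "thin M A (Y - insert y B)"
      using less.prems(5) by (rule thin_mono) auto
    ultimately obtain Ds where "?contraction A (insert y B) Ds"
      using less.hyps[of A "insert y B"] y(2) less.prems(1,2) by auto
    then show ?thesis
      by (rule prepend) (use merge_parts_collapse[OF y(1) less.prems(4)] in
          \<open>simp add: merge_step_def\<close>)
  qed
  show ?case
  proof (cases "\<exists>a\<in>A. \<exists>y\<in>Y-B. M a y")
    case True
    \<comment> \<open>Here \<open>A\<close> is ahead: no 1-entry leads from outside \<open>A\<close>
      into \<open>B\<close>, so \<open>B\<close> can grow, and \<open>y\<close> shows
      \<open>B \<noteq> Y\<close>.\<close>
    then obtain a y where "a \<in> A" "y \<in> Y - B" "M a y" by blast
    then show ?thesis
      using grow_B increasing_matching_no_crossing[OF r(1,2) M less.prems(1,3)] by blast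
  next
    case False
    \<comment> \<open>While \<open>A \<noteq> X\<close>, the row segment grows. Once
      \<open>A = X\<close>, the condition for growing \<open>B\<close> holds vacuously.\<close>
    consider "A \<noteq> X" | "A = X" "B \<noteq> Y" | "A = X" "B = Y" by blast
    then show ?thesis
    proof cases
      case 3
      then show ?thesis using E by (intro exI[of _ "[?E]"]) (simp add: collapse_full)
    qed (use grow_A[OF _ False] grow_B in auto)
  qed
qed

text \<open>Finiteness gives meaning to the \<open>Max\<close> in \<open>sequence_width\<close>, for
  upper and lower bounds alike.\<close>

lemma finite_line_counts_Union:
  assumes "finite X" "finite Y" "division_sequence X r Y s Ds"
  shows "finite (\<Union>E\<in>set Ds. line_counts (fst E) (snd E) N)"
proof -
  have "finite (fst E) \<and> finite (snd E)" if "E \<in> set Ds" for E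
  proof -
    have "partition_on X (fst E)" "partition_on Y (snd E)"
      using that assms(3)
      by (auto simp: division_sequence_def division_def interval_partition_def)
    then show ?thesis 
      by (intro conjI finite_elements[OF assms(1)] finite_elements[OF assms(2)])
  qed
  then show ?thesis by (auto simp: line_counts_def)
qed

lemma finite_stww_increasing_matching_le:
  assumes r: "linear_order_on C r" "X \<subseteq> C" "finite X" "X \<noteq> {}"
    and s: "linear_order_on D s" "Y \<subseteq> D" "finite Y" "Y \<noteq> {}"
    and M: "increasing_matching X r Y s M"
  shows "finite_stww X r Y s M \<le> 2"
proof -
  \<comment> \<open>Extending the empty segment gives the least row, and likewise the least column;
    collapsing these singletons changes nothing, so the contraction starts at the division into
    singletons.\<close>
  obtain x where x: "x \<in> X" "initial_segment X r {x}"
    using extend_initial_segment[OF r(1-3), of "{}"] r(4) by (auto simp: initial_segment_def)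
  obtain y where y: "y \<in> Y" "initial_segment Y s {y}"
    using extend_initial_segment[OF s(1-3), of "{}"] s(4) by (auto simp: initial_segment_def)
  have thin: "thin M {x} (Y - {y})" "thin M\<inverse>\<inverse> {y} (X - {x})"
    using M x(1) y(1) by (auto simp: thin_def increasing_matching_def)
  obtain Ds where Ds: "division_sequence X r Y s Ds"
    and w: "\<forall>E\<in>set Ds. line_counts (fst E) (snd E) (quotient_matrix M) \<subseteq> {..2}"
    using contraction_from_collapse[OF r(1-3) s(1-3) M x(2) _ y(2) _ thin]
    by (auto simp: division_sequence_def collapse_singleton x(1) y(1))
  let ?L = "\<Union>E\<in>set Ds. line_counts (fst E) (snd E) (quotient_matrix M)"
  have "(singletons X, singletons Y) \<in> set Ds"
    using Ds hd_in_set unfolding division_sequence_def by metis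
  then have "?L \<noteq> {}"
    using r(4) by (force simp: line_counts_def singletons_def)
  then have "sequence_width M Ds \<le> 2"
    unfolding sequence_width_def
    using finite_line_counts_Union[OF r(3) s(3) Ds] w by (subst Max_le_iff) auto
  then have "enat (sequence_width M Ds) \<le> 2" by (simp add: numeral_eq_enat)
  moreover have "finite_stww X r Y s M \<le> enat (sequence_width M Ds)"
    unfolding finite_stww_def using Ds by (intro INF_lower) simp
  ultimately show ?thesis by order
qed

text \<open>The matching property passes to submatrices. For empty \<open>C\<close> there is no
  division sequence and the infimum would be \<infinity>, hence
  \<open>C \<noteq> {}\<close>.\<close>

lemma stww_increasing_matching_le:
  assumes "linear_order_on C r" "C \<noteq> {}" "increasing_matching C r C r M"
  shows "stww C r C r M \<le> 2"
proof -
  have *: "finite_stww X r Y r M \<le> 2"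
    if "X \<subseteq> C" "finite X" "X \<noteq> {}" "Y \<subseteq> C" "finite Y" "Y \<noteq> {}" for X Y
  proof (rule finite_stww_increasing_matching_le[OF assms(1) that(1-3) assms(1) that(4-6)])
    show "increasing_matching X r Y r M"
      using assms(3) that(1,4) unfolding increasing_matching_def by blast
  qed
  then show ?thesis
    using assms(2) unfolding stww_def by (auto intro!: SUP_least)
qed

section \<open>Lower bound for identity matrices\<close>

lemma merge_parts_singletons:
  assumes "merge_parts (singletons X) P"
  obtains a b where "a \<in> X" "b \<in> X" "a \<noteq> b" "{a, b} \<in> P"
proof -
  obtain A B where AB: "A \<in> singletons X" "B \<in> singletons X" "A \<noteq> B" "A \<union> B \<in> P"
    using assms unfolding merge_parts_def by blast
  then obtain a b where "A = {a}" "B = {b}" "a \<in> X" "b \<in> X"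
    by (auto simp: singletons_def)
  with AB show thesis by (intro that[of a b]) (auto simp: insert_commute)
qed

lemma card_singletons_meeting_pair:
  assumes "a \<in> X" "b \<in> X" "a \<noteq> b" "\<And>x y. x \<in> X \<Longrightarrow> y \<in> X \<Longrightarrow> M x y \<longleftrightarrow> x = y"
  shows "card {J \<in> singletons X. quotient_matrix M {a, b} J} = 2"
    and "card {I \<in> singletons X. quotient_matrix M I {a, b}} = 2"
proof -
  have "{J \<in> singletons X. quotient_matrix M {a, b} J} = {{a}, {b}}"
    "{I \<in> singletons X. quotient_matrix M I {a, b}} = {{a}, {b}}"
    using assms by (auto simp: singletons_def quotient_matrix_def)
  then show "card {J \<in> singletons X. quotient_matrix M {a, b} J} = 2"
    and "card {I \<in> singletons X. quotient_matrix M I {a, b}} = 2"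
    using assms(3) by simp_all
qed

lemma finite_stww_identity_ge:
  assumes "finite X" "u \<in> X" "v \<in> X" "u \<noteq> v"
    and M: "\<And>x y. x \<in> X \<Longrightarrow> y \<in> X \<Longrightarrow> M x y \<longleftrightarrow> x = y"
  shows "2 \<le> finite_stww X r X s M"
  unfolding finite_stww_def
proof (intro INF_greatest)
  fix Ds assume "Ds \<in> {Ds. division_sequence X r X s Ds}"
  then have Ds: "division_sequence X r X s Ds" by simp
  \<comment> \<open>Two distinct points keep the first division from being the last, so the sequence
    contains a first merge. It joins two singletons on one side while the other side is still
    divided into singletons.\<close>
  have "singletons X \<noteq> {X}" using assms(2-4) by (auto simp: singletons_def)
  then obtain E Es where E: "Ds = (singletons X, singletons X) # E # Es"
    and step: "merge_step (singletons X, singletons X) E"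
    using Ds by (cases Ds; cases "tl Ds") (auto simp: division_sequence_def)
  have "2 \<in> line_counts (fst E) (snd E) (quotient_matrix M)"
    using step unfolding merge_step_def
  proof (elim disjE conjE)
    assume *: "merge_parts (fst (singletons X, singletons X)) (fst E)"
      "snd E = snd (singletons X, singletons X)"
    then obtain a b where ab: "a \<in> X" "b \<in> X" "a \<noteq> b" "{a, b} \<in> fst E"
      using merge_parts_singletons by (metis fst_conv)
    with * card_singletons_meeting_pair(1)[OF ab(1-3) M, symmetric]
    show ?thesis unfolding line_counts_def by auto
  next
    assume *: "fst E = fst (singletons X, singletons X)"
      "merge_parts (snd (singletons X, singletons X)) (snd E)"
    then obtain a b where ab: "a \<in> X" "b \<in> X" "a \<noteq> b" "{a, b} \<in> snd E"
      using merge_parts_singletons by (metis snd_conv)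
    with * card_singletons_meeting_pair(2)[OF ab(1-3) M, symmetric]
    show ?thesis unfolding line_counts_def by auto
  qed
  then have "2 \<le> sequence_width M Ds"
    unfolding sequence_width_def
    using finite_line_counts_Union[OF assms(1,1) Ds] by (intro Max_ge) (auto simp: E)
  then show "2 \<le> enat (sequence_width M Ds)" by (simp add: numeral_eq_enat)
qed

text \<open>In the infinite case the submatrix on \<open>{u, v}\<close> already forces width
  2.\<close>

lemma stww_identity_ge:
  assumes "u \<in> C" "v \<in> C" "u \<noteq> v" "\<And>x y. x \<in> C \<Longrightarrow> y \<in> C \<Longrightarrow> M x y \<longleftrightarrow> x = y"
  shows "2 \<le> stww C r C s M"
proof (cases "finite C")
  case True
  then show ?thesis using finite_stww_identity_ge[OF True assms] by (simp add: stww_def)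
next
  case False
  have "2 \<le> finite_stww {u, v} r {u, v} s M"
    using assms by (intro finite_stww_identity_ge[of _ u v]) auto
  then show ?thesis
    using False assms(1,2) unfolding stww_def
    by (auto intro!: SUP_upper2[where i = "({u, v}, {u, v})"])
qed

section \<open>Translation matrices of right-orderable groups\<close>

lemma increasing_matching_translation:
  assumes "group G" and r: "linear_order_on (carrier G) r"
    and inv: "\<And>x y z. x \<in> carrier G \<Longrightarrow> y \<in> carrier G \<Longrightarrow> z \<in> carrier G \<Longrightarrow>
      (x, y) \<in> r \<Longrightarrow> x \<noteq> y \<Longrightarrow> (x \<otimes>\<^bsub>G\<^esub> z, y \<otimes>\<^bsub>G\<^esub> z) \<in> r"
    and g: "g \<in> carrier G"
  shows "increasing_matching (carrier G) r (carrier G) r (translation_matrix G g)"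
proof -
  interpret group G by fact
  have "((x, y) \<in> r \<longleftrightarrow> (x \<otimes>\<^bsub>G\<^esub> g, y \<otimes>\<^bsub>G\<^esub> g) \<in> r) \<and> (x = y \<longleftrightarrow> x \<otimes>\<^bsub>G\<^esub> g = y \<otimes>\<^bsub>G\<^esub> g)"
    if xy: "x \<in> carrier G" "y \<in> carrier G" for x y
  proof (cases "x = y")
    case True
    then show ?thesis using r xy g by (auto simp: order_on_defs refl_on_def)
  next
    case False
    have ne: "x \<otimes>\<^bsub>G\<^esub> g \<noteq> y \<otimes>\<^bsub>G\<^esub> g" using False xy g by simp
    have "(x, y) \<in> r \<or> (y, x) \<in> r" and "antisym r"
      using r xy False by (auto simp: order_on_defs total_on_def)
    \<comment> \<open>Invariance gives the forward implication. For the converse, if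
      \<open>y\<close> is below \<open>x\<close>, then \<open>y g\<close> is strictly below
      \<open>x g\<close>, which antisymmetry excludes.\<close>
    then show ?thesis
      using inv[OF xy g] inv[OF xy(2,1) g] False ne by (auto dest: antisymD)
  qed
  then show ?thesis unfolding increasing_matching_def translation_matrix_def by blast
qed

theorem proposition5p2:
  fixes G :: "('a, 'b) monoid_scheme"
  assumes "group G"
    and "right_orderable G"
  shows "utww G \<le> 2 \<and> (carrier G \<noteq> {\<one>\<^bsub>G\<^esub>} \<longrightarrow> utww G = 2)"
proof -
  interpret group G by fact
  obtain r where r: "linear_order_on (carrier G) r"
    and inv: "\<And>x y z. x \<in> carrier G \<Longrightarrow> y \<in> carrier G \<Longrightarrow> z \<in> carrier G \<Longrightarrow>
      (x, y) \<in> r \<Longrightarrow> x \<noteq> y \<Longrightarrow> (x \<otimes>\<^bsub>G\<^esub> z, y \<otimes>\<^bsub>G\<^esub> z) \<in> r"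
    using assms(2) unfolding right_orderable_def by blast
  have "stww (carrier G) r (carrier G) r (translation_matrix G g) \<le> 2"
    if "g \<in> carrier G" for g
    using increasing_matching_translation[OF assms(1) r inv that]
    by (intro stww_increasing_matching_le r) auto
  then have upper: "utww G \<le> 2"
    unfolding utww_def using r by (intro INF_lower2[of r] SUP_least) auto
  have "2 \<le> utww G" if nontrivial: "carrier G \<noteq> {\<one>\<^bsub>G\<^esub>}"
  proof -
    obtain a where a: "a \<in> carrier G" "a \<noteq> \<one>\<^bsub>G\<^esub>" using nontrivial one_closed by blast
    \<comment> \<open>The bound holds for every \<open>s\<close>, as required by the infimum over
      all orders in \<open>utww\<close>.\<close>
    have "2 \<le> stww (carrier G) s (carrier G) s (translation_matrix G \<one>\<^bsub>G\<^esub>)" for s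
      using a by (intro stww_identity_ge[of a _ "\<one>\<^bsub>G\<^esub>"]) (auto simp: translation_matrix_def)
    then show ?thesis
      unfolding utww_def by (intro INF_greatest SUP_upper2[of "\<one>\<^bsub>G\<^esub>"]) auto
  qed
  with upper show ?thesis by (auto intro: antisym)
qed

end
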